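(* Let $\mathbb{R}_{+}^{\star}$ be the multiplicative group of positive real numbers and let $\mathbb{R}_{-}^{\star}=\{x\in\mathbb{R}: x<0\}$ be the group with law $x\cdot y=-xy$ (where $xy$ is the ordinary product of real numbers). Then the direct product group $\mathbb{R}_{+}^{\star}\times\mathbb{R}_{-}^{\star}$ is isomorphic to the group $(\mathbb{C},+)$. *)

theory Defs
  imports Complex_Main "HOL-Algebra.Group"
begin

definition pos_real_group :: "real monoid" where
  "pos_real_group = \<lparr>carrier = {x. x > 0}, monoid.mult = (\<lambda>x y. x * y), one = 1\<rparr>"

definition neg_real_group :: "real monoid" where
  "neg_real_group = \<lparr>carrier = {x. x < 0}, monoid.mult = (\<lambda>x y. - (x * y)), one = - 1\<rparr>"

definition complex_add_group :: "complex monoid" where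
  "complex_add_group = \<lparr>carrier = UNIV, monoid.mult = (\<lambda>z w. z + w), one = 0\<rparr>"

lemma comm_group_pos_real_group: "comm_group pos_real_group"
proof (rule comm_groupI)
  fix x assume "x \<in> carrier pos_real_group"
  then show "\<exists>y\<in>carrier pos_real_group. y \<otimes>\<^bsub>pos_real_group\<^esub> x = \<one>\<^bsub>pos_real_group\<^esub>"
    by (intro bexI[of _ "inverse x"]) (auto simp: pos_real_group_def)
qed (auto simp: pos_real_group_def)

lemma comm_group_neg_real_group: "comm_group neg_real_group"
proof (rule comm_groupI)
  fix x assume "x \<in> carrier neg_real_group"
  then show "\<exists>y\<in>carrier neg_real_group. y \<otimes>\<^bsub>neg_real_group\<^esub> x = \<one>\<^bsub>neg_real_group\<^esub>"
    by (intro bexI[of _ "inverse x"]) (auto simp: neg_real_group_def)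
qed (auto simp: neg_real_group_def mult_neg_neg)

lemma comm_group_complex_add_group: "comm_group complex_add_group"
proof (rule comm_groupI)
  fix x assume "x \<in> carrier complex_add_group"
  show "\<exists>y\<in>carrier complex_add_group. y \<otimes>\<^bsub>complex_add_group\<^esub> x = \<one>\<^bsub>complex_add_group\<^esub>"
    by (intro bexI[of _ "- x"]) (auto simp: complex_add_group_def)
qed (auto simp: complex_add_group_def)

end

theory Submission
  imports Defs
begin

text \<open>
  Negation carries the negative reals with the law \<open>- (x * y)\<close> onto the multiplicative group of
  positive reals, and the logarithm turns the latter into the additive group of reals. Doing this
  in both factors and reading the two logarithms as real and imaginary part gives the isomorphism,
  whose inverse exponentiates the two parts.
\<close>

theorem mainTheorem8:
  shows "pos_real_group \<times>\<times> neg_real_group \<cong> complex_add_group"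
proof (rule is_isoI, rule isoI)
  let ?f = "\<lambda>(x, y). Complex (ln x) (ln (- y))"
  show "?f \<in> hom (pos_real_group \<times>\<times> neg_real_group) complex_add_group"
  proof (rule homI)
    fix p q
    assume p: "p \<in> carrier (pos_real_group \<times>\<times> neg_real_group)"
      and q: "q \<in> carrier (pos_real_group \<times>\<times> neg_real_group)"
    obtain x y x' y' where pq: "p = (x, y)" "q = (x', y')"
      by (metis surj_pair)
    have pos: "x > 0" "x' > 0" and neg: "y < 0" "y' < 0"
      using p q by (auto simp: pq pos_real_group_def neg_real_group_def)
    have "ln (y * y') = ln (- y) + ln (- y')"
      using ln_mult_pos[of "- y" "- y'"] neg by simp
    then show "?f (p \<otimes>\<^bsub>pos_real_group \<times>\<times> neg_real_group\<^esub> q) = ?f p \<otimes>\<^bsub>complex_add_group\<^esub> ?f q"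
      using pos by (simp add: pq pos_real_group_def neg_real_group_def complex_add_group_def
          ln_mult_pos complex_eq_iff)
  qed (simp add: complex_add_group_def)
  show "bij_betw ?f (carrier (pos_real_group \<times>\<times> neg_real_group)) (carrier complex_add_group)"
    by (rule bij_betw_byWitness[where f' = "\<lambda>z. (exp (Re z), - exp (Im z))"])
      (auto simp: pos_real_group_def neg_real_group_def complex_add_group_def)
qed

end
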